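(* Let $G$ be a group with subgroups $A,B\le G$, let $\varphi:A\to B$ be an isomorphism, and let $\Gamma=G*_\varphi t$ be the HNN-extension of the base group $G$ by the stable letter $t$ with respect to $\varphi$. Let $G'\le G$ be a subgroup such that for $A'=G'\cap A$ and $B'=G'\cap B$ we have $\varphi(A')=B'$. Let $\Gamma'=\langle G',t\rangle$ be the subgroup of $\Gamma$ generated by $G'$ and $t$, and let $\varphi':A'\to B'$ be the restriction of $\varphi$ to $A'$. Then: (1) $\Gamma'=G'*_{\varphi'}t$; (2) $\Gamma'\cap G=G'$; (3) $\Gamma'\cap A=A'$ and $\Gamma'\cap B=B'$.
   Context: Notation: $x^y=y^{-1}xy$. For an isomorphism $\varphi:A\to B$ of subgroups of $G$, the HNN-extension $G*_\varphi t$ is $\langle G,t\mid a^t=\varphi(a)\text{ for all }a\in A\rangle$. The group $G$ is identified with its natural image in $G*_\varphi t$. The equality $\Gamma'=G'*_{\varphi'}t$ means that the natural homomorphism from the HNN-extension $G'*_{\varphi'}t$ to $\Gamma$ (inclusion on $G'$, $t\mapsto t$) is injective with image $\Gamma'$. *)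

theory Defs
  imports "HOL-Algebra.Generated_Groups"
begin

text \<open>
  HNN-extensions \<open>\<langle>G, t | t\<^sup>-\<^sup>1 a t = \<phi> a for a \<in> A\<rangle>\<close>, built as the monoid of words in
  the elements of \<open>G\<close>, \<open>t\<close> and \<open>t\<^sup>-\<^sup>1\<close> modulo the least congruence containing the multiplication
  table of \<open>G\<close>, the cancellations of \<open>t\<close> against \<open>t\<^sup>-\<^sup>1\<close>, and the relations \<open>t\<^sup>-\<^sup>1 a t = \<phi> a\<close>.
  The associated subgroup \<open>B\<close> is \<open>\<phi> ` A\<close> and hence not a parameter.
  An inverse of \<open>x \<in> G\<close> is provided by the multiplication table, so the quotient is a group, and
  it is the group with this presentation (\<open>group_hnn\<close>, \<open>stable_conj\<close>, \<open>hnn_lift_exists\<close>,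
  \<open>hnn_lift_unique\<close> below).  The image of the base group is not identified with \<open>G\<close> but given
  by the canonical map \<open>hnn_base G A \<phi>\<close>.
\<close>

datatype 'a hnn_letter = Base 'a | Stable | StableInv

definition hnn_words :: "('a, 'm) monoid_scheme \<Rightarrow> 'a hnn_letter list set" where
  "hnn_words G = lists (Base ` carrier G \<union> {Stable, StableInv})"

inductive hnn_cong ::
    "('a, 'm) monoid_scheme \<Rightarrow> 'a set \<Rightarrow> ('a \<Rightarrow> 'a) \<Rightarrow>
      'a hnn_letter list \<Rightarrow> 'a hnn_letter list \<Rightarrow> bool"
  for G A \<phi> where
  refl: "w \<in> hnn_words G \<Longrightarrow> hnn_cong G A \<phi> w w"
| sym: "hnn_cong G A \<phi> u v \<Longrightarrow> hnn_cong G A \<phi> v u"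
| trans: "hnn_cong G A \<phi> u v \<Longrightarrow> hnn_cong G A \<phi> v w \<Longrightarrow> hnn_cong G A \<phi> u w"
| append: "hnn_cong G A \<phi> u u' \<Longrightarrow> hnn_cong G A \<phi> v v' \<Longrightarrow> hnn_cong G A \<phi> (u @ v) (u' @ v')"
| base_one: "hnn_cong G A \<phi> [Base \<one>\<^bsub>G\<^esub>] []"
| base_mult: "x \<in> carrier G \<Longrightarrow> y \<in> carrier G \<Longrightarrow>
    hnn_cong G A \<phi> [Base x, Base y] [Base (x \<otimes>\<^bsub>G\<^esub> y)]"
| stable_inv_right: "hnn_cong G A \<phi> [Stable, StableInv] []"
| stable_inv_left: "hnn_cong G A \<phi> [StableInv, Stable] []"
| conjugate: "a \<in> A \<Longrightarrow> hnn_cong G A \<phi> [StableInv, Base a, Stable] [Base (\<phi> a)]"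

definition hnn_rel ::
    "('a, 'm) monoid_scheme \<Rightarrow> 'a set \<Rightarrow> ('a \<Rightarrow> 'a) \<Rightarrow> 'a hnn_letter list rel" where
  "hnn_rel G A \<phi> = {(u, v). hnn_cong G A \<phi> u v}"

definition hnn ::
    "('a, 'm) monoid_scheme \<Rightarrow> 'a set \<Rightarrow> ('a \<Rightarrow> 'a) \<Rightarrow> 'a hnn_letter list set monoid" where
  "hnn G A \<phi> =
    \<lparr>carrier = hnn_words G // hnn_rel G A \<phi>,
     mult = (\<lambda>U V. \<Union>x\<in>U. \<Union>y\<in>V. hnn_rel G A \<phi> `` {x @ y}),
     one = hnn_rel G A \<phi> `` {[]}\<rparr>"

definition hnn_base ::
    "('a, 'm) monoid_scheme \<Rightarrow> 'a set \<Rightarrow> ('a \<Rightarrow> 'a) \<Rightarrow> 'a \<Rightarrow> 'a hnn_letter list set" where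
  "hnn_base G A \<phi> g = hnn_rel G A \<phi> `` {[Base g]}"

definition hnn_stable ::
    "('a, 'm) monoid_scheme \<Rightarrow> 'a set \<Rightarrow> ('a \<Rightarrow> 'a) \<Rightarrow> 'a hnn_letter list set" where
  "hnn_stable G A \<phi> = hnn_rel G A \<phi> `` {[Stable]}"

locale hnn_data = group G for G :: "('a, 'm) monoid_scheme" (structure) +
  fixes A :: "'a set" and \<phi> :: "'a \<Rightarrow> 'a"
  assumes A_sub: "A \<subseteq> carrier G" and phi_closed: "a \<in> A \<Longrightarrow> \<phi> a \<in> carrier G"
begin

abbreviation cls where "cls w \<equiv> hnn_rel G A \<phi> `` {w}"

lemma words_simps [simp]:
  "[] \<in> hnn_words G"
  "l # w \<in> hnn_words G \<longleftrightarrow>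
    (case l of Base x \<Rightarrow> x \<in> carrier G | _ \<Rightarrow> True) \<and> w \<in> hnn_words G"
  "u @ v \<in> hnn_words G \<longleftrightarrow> u \<in> hnn_words G \<and> v \<in> hnn_words G"
  by (auto simp: hnn_words_def split: hnn_letter.splits)

lemma cong_words: "hnn_cong G A \<phi> u v \<Longrightarrow> u \<in> hnn_words G \<and> v \<in> hnn_words G"
  by (induction rule: hnn_cong.induct) (use A_sub phi_closed in auto)

lemma equiv_rel: "equiv (hnn_words G) (hnn_rel G A \<phi>)"
proof (rule equivI)
  show "hnn_rel G A \<phi> \<subseteq> hnn_words G \<times> hnn_words G"
    unfolding hnn_rel_def using cong_words by blast
  show "refl_on (hnn_words G) (hnn_rel G A \<phi>)"
    by (intro refl_onI) (simp add: hnn_rel_def hnn_cong.refl)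
  show "Relation.sym (hnn_rel G A \<phi>)"
    by (intro symI) (simp add: hnn_rel_def hnn_cong.sym)
  show "Relation.trans (hnn_rel G A \<phi>)"
    unfolding hnn_rel_def by (intro transI, unfold mem_Collect_eq case_prod_conv) (rule hnn_cong.trans)
qed

lemma cls_eq_iff: "u \<in> hnn_words G \<Longrightarrow> v \<in> hnn_words G \<Longrightarrow> cls u = cls v \<longleftrightarrow> hnn_cong G A \<phi> u v"
  using eq_equiv_class_iff[OF equiv_rel] by (simp add: hnn_rel_def)

lemma cls_eqI: "hnn_cong G A \<phi> u v \<Longrightarrow> cls u = cls v"
  using cls_eq_iff cong_words by blast

lemma carrier_hnn: "carrier (hnn G A \<phi>) = cls ` hnn_words G"
  by (auto simp: hnn_def quotient_def)

lemma one_hnn: "\<one>\<^bsub>hnn G A \<phi>\<^esub> = cls []"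
  by (simp add: hnn_def)

lemma mult_hnn:
  assumes "u \<in> hnn_words G" "v \<in> hnn_words G"
  shows "cls u \<otimes>\<^bsub>hnn G A \<phi>\<^esub> cls v = cls (u @ v)"
proof -
  have "cls (x @ y) = cls (u @ v)" if "x \<in> cls u" "y \<in> cls v" for x y
    using that by (intro cls_eqI hnn_cong.append) (simp_all add: hnn_rel_def hnn_cong.sym)
  moreover have "u \<in> cls u" "v \<in> cls v"
    using assms by (simp_all add: hnn_rel_def hnn_cong.refl)
  ultimately have "(\<Union>x\<in>cls u. \<Union>y\<in>cls v. cls (x @ y)) = cls (u @ v)"
    by blast
  then show ?thesis by (simp add: hnn_def)
qed

lemma left_inverse_word:
  assumes "w \<in> hnn_words G"
  shows "\<exists>v \<in> hnn_words G. hnn_cong G A \<phi> (v @ w) []"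
  using assms
proof (induction w)
  case Nil
  show ?case by (rule bexI[of _ "[]"]) (auto intro: hnn_cong.refl)
next
  case (Cons l w)
  then obtain v where v: "v \<in> hnn_words G" "hnn_cong G A \<phi> (v @ w) []" by auto
  have w: "w \<in> hnn_words G" using Cons.prems by simp
  have "\<exists>k. [k] \<in> hnn_words G \<and> hnn_cong G A \<phi> [k, l] []"
  proof (cases l)
    case (Base x)
    then have x: "x \<in> carrier G" using Cons.prems by simp
    then have "hnn_cong G A \<phi> [Base (inv x), Base x] [Base (inv x \<otimes> x)]"
      by (intro hnn_cong.base_mult) simp_all
    then have "hnn_cong G A \<phi> [Base (inv x), Base x] []"
      using x hnn_cong.base_one[of G A \<phi>] by (auto intro: hnn_cong.trans[rotated])
    then show ?thesis using Base x by (intro exI[of _ "Base (inv x)"]) simp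
  next
    case Stable
    then show ?thesis by (intro exI[of _ StableInv]) (simp add: hnn_cong.stable_inv_left)
  next
    case StableInv
    then show ?thesis by (intro exI[of _ Stable]) (simp add: hnn_cong.stable_inv_right)
  qed
  then obtain k where k: "[k] \<in> hnn_words G" "hnn_cong G A \<phi> [k, l] []" by blast
  have "hnn_cong G A \<phi> (v @ [k, l] @ w) (v @ [] @ w)"
    using v w k by (intro hnn_cong.append hnn_cong.refl)
  then have "hnn_cong G A \<phi> ((v @ [k]) @ l # w) []"
    using hnn_cong.trans[OF _ v(2)] by simp
  then show ?case using v k by (intro bexI[of _ "v @ [k]"]) auto
qed

lemma group_hnn: "group (hnn G A \<phi>)"
proof (rule groupI)
  fix U assume "U \<in> carrier (hnn G A \<phi>)"
  then obtain w where w: "w \<in> hnn_words G" "U = cls w" by (auto simp: carrier_hnn)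
  obtain v where v: "v \<in> hnn_words G" "hnn_cong G A \<phi> (v @ w) []"
    using left_inverse_word w by blast
  show "\<exists>V\<in>carrier (hnn G A \<phi>). V \<otimes>\<^bsub>hnn G A \<phi>\<^esub> U = \<one>\<^bsub>hnn G A \<phi>\<^esub>"
    using v w by (intro bexI[of _ "cls v"]) (auto simp: carrier_hnn one_hnn mult_hnn cls_eqI)
next
  fix U V assume "U \<in> carrier (hnn G A \<phi>)" "V \<in> carrier (hnn G A \<phi>)"
  then show "U \<otimes>\<^bsub>hnn G A \<phi>\<^esub> V \<in> carrier (hnn G A \<phi>)"
    unfolding carrier_hnn by (elim imageE) (simp add: mult_hnn)
next
  fix U V W
  assume "U \<in> carrier (hnn G A \<phi>)" "V \<in> carrier (hnn G A \<phi>)" "W \<in> carrier (hnn G A \<phi>)"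
  then show "U \<otimes>\<^bsub>hnn G A \<phi>\<^esub> V \<otimes>\<^bsub>hnn G A \<phi>\<^esub> W
      = U \<otimes>\<^bsub>hnn G A \<phi>\<^esub> (V \<otimes>\<^bsub>hnn G A \<phi>\<^esub> W)"
    unfolding carrier_hnn by (elim imageE) (simp add: mult_hnn)
next
  fix U assume "U \<in> carrier (hnn G A \<phi>)"
  then show "\<one>\<^bsub>hnn G A \<phi>\<^esub> \<otimes>\<^bsub>hnn G A \<phi>\<^esub> U = U"
    unfolding carrier_hnn by (elim imageE) (simp add: mult_hnn one_hnn)
qed (simp add: carrier_hnn one_hnn)

lemma base_closed: "g \<in> carrier G \<Longrightarrow> hnn_base G A \<phi> g \<in> carrier (hnn G A \<phi>)"
  by (simp add: hnn_base_def carrier_hnn)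

lemma stable_closed: "hnn_stable G A \<phi> \<in> carrier (hnn G A \<phi>)"
  by (simp add: hnn_stable_def carrier_hnn)

lemma base_hom: "hnn_base G A \<phi> \<in> hom G (hnn G A \<phi>)"
proof (rule homI)
  fix x y assume "x \<in> carrier G" "y \<in> carrier G"
  then show "hnn_base G A \<phi> (x \<otimes> y)
      = hnn_base G A \<phi> x \<otimes>\<^bsub>hnn G A \<phi>\<^esub> hnn_base G A \<phi> y"
    by (simp add: hnn_base_def mult_hnn cls_eqI[OF hnn_cong.base_mult])
qed (rule base_closed)

lemma inv_stable: "inv\<^bsub>hnn G A \<phi>\<^esub> hnn_stable G A \<phi> = cls [StableInv]"
proof -
  interpret H: group "hnn G A \<phi>" by (rule group_hnn)
  have "cls [StableInv] \<otimes>\<^bsub>hnn G A \<phi>\<^esub> hnn_stable G A \<phi> = \<one>\<^bsub>hnn G A \<phi>\<^esub>"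
    by (simp add: hnn_stable_def mult_hnn one_hnn cls_eqI[OF hnn_cong.stable_inv_left])
  then show ?thesis by (intro H.inv_equality stable_closed) (auto simp: carrier_hnn)
qed

lemma stable_conj:
  assumes "a \<in> A"
  shows "inv\<^bsub>hnn G A \<phi>\<^esub> hnn_stable G A \<phi> \<otimes>\<^bsub>hnn G A \<phi>\<^esub> hnn_base G A \<phi> a
      \<otimes>\<^bsub>hnn G A \<phi>\<^esub> hnn_stable G A \<phi> = hnn_base G A \<phi> (\<phi> a)"
proof -
  have "a \<in> carrier G" using assms A_sub by blast
  then show ?thesis
    unfolding inv_stable
    by (simp add: hnn_base_def hnn_stable_def mult_hnn cls_eqI[OF hnn_cong.conjugate[OF assms]])
qed

end

text \<open>The universal property of the presentation.\<close>

fun hnn_eval_letter :: "('b, 'n) monoid_scheme \<Rightarrow> ('a \<Rightarrow> 'b) \<Rightarrow> 'b \<Rightarrow> 'a hnn_letter \<Rightarrow> 'b" where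
  "hnn_eval_letter H f s (Base x) = f x"
| "hnn_eval_letter H f s Stable = s"
| "hnn_eval_letter H f s StableInv = inv\<^bsub>H\<^esub> s"

primrec hnn_eval :: "('b, 'n) monoid_scheme \<Rightarrow> ('a \<Rightarrow> 'b) \<Rightarrow> 'b \<Rightarrow> 'a hnn_letter list \<Rightarrow> 'b" where
  "hnn_eval H f s [] = \<one>\<^bsub>H\<^esub>"
| "hnn_eval H f s (l # w) = hnn_eval_letter H f s l \<otimes>\<^bsub>H\<^esub> hnn_eval H f s w"

context hnn_data
begin

lemma hnn_lift_exists:
  assumes H: "group H" and f: "f \<in> hom G H" and s: "s \<in> carrier H"
    and conj: "\<And>a. a \<in> A \<Longrightarrow> inv\<^bsub>H\<^esub> s \<otimes>\<^bsub>H\<^esub> f a \<otimes>\<^bsub>H\<^esub> s = f (\<phi> a)"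
  shows "\<exists>h \<in> hom (hnn G A \<phi>) H.
    (\<forall>g \<in> carrier G. h (hnn_base G A \<phi> g) = f g) \<and> h (hnn_stable G A \<phi>) = s"
proof -
  interpret H: group H by (rule H)
  interpret f: group_hom G H f
    using f is_group H by (simp add: group_hom_def group_hom_axioms_def)
  let ?e = "hnn_eval H f s"
  have closed: "?e w \<in> carrier H" if "w \<in> hnn_words G" for w
    using that s by (induction w) (auto split: hnn_letter.splits)
  have app: "?e (u @ v) = ?e u \<otimes>\<^bsub>H\<^esub> ?e v" if "u \<in> hnn_words G" "v \<in> hnn_words G" for u v
    using that s closed
    by (induction u) (auto simp: H.m_assoc split: hnn_letter.splits)
  have eq: "?e u = ?e v" if "hnn_cong G A \<phi> u v" for u v
    using that
  proof (induction rule: hnn_cong.induct)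
    case (append u u' v v')
    then show ?case using cong_words app by metis
  next
    case (conjugate a)
    then show ?case using conj[of a] s A_sub phi_closed[of a] by (auto simp: H.m_assoc)
  qed (use s in auto)
  define h where "h U = ?e (SOME w. w \<in> U)" for U
  have h: "h (cls w) = ?e w" if "w \<in> hnn_words G" for w
  proof -
    have "w \<in> cls w" using that by (simp add: hnn_rel_def hnn_cong.refl)
    then have "(SOME v. v \<in> cls w) \<in> cls w" by (rule someI)
    then show ?thesis unfolding h_def using eq[of w] by (auto simp: hnn_rel_def)
  qed
  have "h \<in> hom (hnn G A \<phi>) H"
    by (rule homI) (auto simp: carrier_hnn mult_hnn h app closed)
  moreover have "h (hnn_base G A \<phi> g) = f g" if "g \<in> carrier G" for g
    using that by (simp add: hnn_base_def h)
  moreover have "h (hnn_stable G A \<phi>) = s"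
    using s by (simp add: hnn_stable_def h)
  ultimately show ?thesis by blast
qed

lemma hnn_lift_unique:
  assumes H: "group H" and h: "h \<in> hom (hnn G A \<phi>) H" and k: "k \<in> hom (hnn G A \<phi>) H"
    and base: "\<And>g. g \<in> carrier G \<Longrightarrow> h (hnn_base G A \<phi> g) = k (hnn_base G A \<phi> g)"
    and stable: "h (hnn_stable G A \<phi>) = k (hnn_stable G A \<phi>)"
    and U: "U \<in> carrier (hnn G A \<phi>)"
  shows "h U = k U"
proof -
  interpret h: group_hom "hnn G A \<phi>" H h
    using h group_hnn H by (simp add: group_hom_def group_hom_axioms_def)
  interpret k: group_hom "hnn G A \<phi>" H k
    using k group_hnn H by (simp add: group_hom_def group_hom_axioms_def)
  have inv: "h (cls [StableInv]) = k (cls [StableInv])"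
    using stable stable_closed by (simp flip: inv_stable)
  have letter: "h (cls [l]) = k (cls [l])" if "[l] \<in> hnn_words G" for l
    using that base stable inv
    by (cases l) (auto simp: hnn_base_def hnn_stable_def)
  have "h (cls w) = k (cls w)" if "w \<in> hnn_words G" for w
    using that
  proof (induction w)
    case Nil
    show ?case using h.hom_one k.hom_one by (simp add: one_hnn)
  next
    case (Cons l w)
    then have l: "[l] \<in> hnn_words G" and w: "w \<in> hnn_words G" by auto
    have c: "cls (l # w) = cls [l] \<otimes>\<^bsub>hnn G A \<phi>\<^esub> cls w"
      using mult_hnn[OF l w] by simp
    have "cls [l] \<in> carrier (hnn G A \<phi>)" "cls w \<in> carrier (hnn G A \<phi>)"
      using l w unfolding carrier_hnn by blast+
    then show ?case unfolding c using Cons.IH[OF w] letter[OF l] by simp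
  qed
  then show ?thesis using U by (auto simp: carrier_hnn)
qed

end

end

theory Submission
  imports Defs
begin

text \<open>
  The HNN-extension acts on its normal forms, and with a suitable choice of coset
  representatives the normal forms of the smaller extension sit inside those of the larger one.

  Write \<open>H\<close> for the subgroup called \<open>G'\<close> in the theorem, and
  \<open>\<Sigma>\<close> for the HNN-extension of \<open>H\<close>. A normal form is an element \<open>g\<close> of \<open>G\<close> followed by
  syllables \<open>t\<^sup>\<plusminus>\<^sup>1 r\<close>, where \<open>r\<close> is the chosen representative of a coset of \<open>A\<close> or \<open>B\<close> and no
  syllable can be cancelled. Words in the elements of \<open>G\<close> and in \<open>t\<^sup>\<plusminus>\<^sup>1\<close> act on normal forms by
  left multiplication followed by normalisation, and the defining relations of \<open>\<Gamma>\<close>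
  hold for this action (\<open>act_cong\<close>). So words that are equal in \<open>\<Gamma>\<close> send the trivial normal
  form to the same place.

  Representatives are chosen in \<open>H\<close> whenever the coset meets \<open>H\<close>. Normalising an element of \<open>H\<close>
  then only involves elements of \<open>H\<close>: if \<open>g = b r\<close> with \<open>b \<in> B\<close> and \<open>g, r \<in> H\<close>, then
  \<open>b \<in> H \<inter> B\<close>, and \<open>\<phi>\<^sup>-\<^sup>1 b \<in> H\<close> because \<open>\<phi>\<close> maps \<open>H \<inter> A\<close> onto \<open>H \<inter> B\<close>; likewise for \<open>A\<close>. Hence words
  over \<open>H\<close> preserve the normal forms over \<open>H\<close>, and every rewriting that occurs on the way is a
  consequence of the relations of \<open>\<Sigma>\<close>. A word over \<open>H\<close> is therefore equal in \<open>\<Sigma>\<close> to the normal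
  form it produces (\<open>sub_act\<close>, \<open>sub_spell_act_origin\<close>).

  Both assertions follow. If two words over \<open>H\<close> are equal in \<open>\<Gamma>\<close>, they produce the same normal
  form and so are equal in \<open>\<Sigma>\<close>: the natural map is injective. If a word over \<open>H\<close> is
  equal in \<open>\<Gamma>\<close> to some \<open>g \<in> G\<close>, it produces the normal form \<open>g\<close> without syllables, which must
  be one over \<open>H\<close>, so \<open>g \<in> H\<close>: this gives all three intersections.
\<close>

section \<open>A subgroup compatible with the associated isomorphism\<close>

locale hnn_compatible_subgroup = group G for G :: "('a, 'm) monoid_scheme" (structure) +
  fixes A B H :: "'a set" and \<phi> :: "'a \<Rightarrow> 'a"
  assumes A: "subgroup A G" and B: "subgroup B G" and H: "subgroup H G"
    and iso: "\<phi> \<in> iso (G\<lparr>carrier := A\<rparr>) (G\<lparr>carrier := B\<rparr>)"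
    and compatible: "\<phi> ` (H \<inter> A) = H \<inter> B"
begin

lemma A_carrier: "x \<in> A \<Longrightarrow> x \<in> carrier G"
  and B_carrier: "x \<in> B \<Longrightarrow> x \<in> carrier G"
  and H_carrier: "x \<in> H \<Longrightarrow> x \<in> carrier G"
  using A B H by (auto dest: subgroup.mem_carrier)

lemma bij_phi: "bij_betw \<phi> A B"
  using iso by (simp add: iso_def)

lemma phi_mult: "x \<in> A \<Longrightarrow> y \<in> A \<Longrightarrow> \<phi> (x \<otimes> y) = \<phi> x \<otimes> \<phi> y"
  using iso by (simp add: iso_def hom_def)

abbreviation sub_base where "sub_base \<equiv> G\<lparr>carrier := H\<rparr>"
abbreviation sub_assoc where "sub_assoc \<equiv> H \<inter> A"
definition sub_phi where "sub_phi = restrict \<phi> sub_assoc"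
abbreviation sub_cong where "sub_cong \<equiv> hnn_cong sub_base sub_assoc sub_phi"

lemma sub_phi_apply [simp]: "a \<in> H \<Longrightarrow> a \<in> A \<Longrightarrow> sub_phi a = \<phi> a"
  by (simp add: sub_phi_def)

sublocale hnn_data G A \<phi>
  using bij_phi by unfold_locales (auto simp: A_carrier B_carrier dest: bij_betwE)

sublocale sub: hnn_data sub_base sub_assoc sub_phi
proof -
  interpret K: group sub_base by (rule subgroup_imp_group[OF H])
  show "hnn_data sub_base sub_assoc sub_phi"
    using compatible by unfold_locales auto
qed

section \<open>Sliding through the stable letter\<close>

text \<open>
  The exponents \<open>1\<close> and \<open>-1\<close> of \<open>t\<close> are the Booleans \<open>True\<close> and \<open>False\<close>, so that the symmetry
  exchanging \<open>(A, \<phi>, t)\<close> with \<open>(B, \<phi>\<^sup>-\<^sup>1, t\<^sup>-\<^sup>1)\<close> is negation and every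
  argument is made once. The set \<open>side e\<close> consists of the elements that \<open>t\<^sup>e\<close> can be moved across
  from left to right: \<open>t\<^sup>e s = slide e s t\<^sup>e\<close>, that is, \<open>t b = \<phi>\<^sup>-\<^sup>1(b) t\<close> for \<open>b \<in> B\<close> and
  \<open>t\<^sup>-\<^sup>1 a = \<phi>(a) t\<^sup>-\<^sup>1\<close> for \<open>a \<in> A\<close>.
\<close>

definition side :: "bool \<Rightarrow> 'a set" where
  "side e = (if e then B else A)"

definition slide :: "bool \<Rightarrow> 'a \<Rightarrow> 'a" where
  "slide e = (if e then inv_into A \<phi> else \<phi>)"

definition stable_power :: "bool \<Rightarrow> 'a hnn_letter" where
  "stable_power e = (if e then Stable else StableInv)"

lemma subgroup_side: "subgroup (side e) G"
  by (simp add: side_def A B)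

lemma side_carrier: "s \<in> side e \<Longrightarrow> s \<in> carrier G"
  using subgroup_side by (rule subgroup.mem_carrier)

lemma slide_closed: "s \<in> side e \<Longrightarrow> slide e s \<in> side (\<not> e)"
  using bij_phi by (auto simp: side_def slide_def bij_betw_def inv_into_into)

lemma slide_carrier: "s \<in> side e \<Longrightarrow> slide e s \<in> carrier G"
  using slide_closed side_carrier by blast

lemma slide_slide: "s \<in> side e \<Longrightarrow> slide (\<not> e) (slide e s) = s"
  using bij_phi by (auto simp: side_def slide_def bij_betw_def f_inv_into_f)

lemma slide_mult:
  assumes s: "s \<in> side e" and u: "u \<in> side e"
  shows "slide e (s \<otimes> u) = slide e s \<otimes> slide e u"
proof (cases e)
  case True
  have "inv_into A \<phi> s \<in> A" "inv_into A \<phi> u \<in> A"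
    using slide_closed[OF s] slide_closed[OF u] True by (auto simp: slide_def side_def)
  moreover from this have "inv_into A \<phi> s \<otimes> inv_into A \<phi> u \<in> A"
    using A by (simp add: subgroup.m_closed)
  moreover have "\<phi> (inv_into A \<phi> s) = s" "\<phi> (inv_into A \<phi> u) = u"
    using slide_slide[OF s] slide_slide[OF u] True by (auto simp: slide_def)
  ultimately show ?thesis
    using True bij_betw_inv_into_left[OF bij_phi] phi_mult[of "inv_into A \<phi> s" "inv_into A \<phi> u"]
    by (simp add: slide_def) (metis (full_types))
next
  case False
  then show ?thesis using s u by (simp add: slide_def side_def phi_mult)
qed

text \<open>
  This is where \<open>\<phi> ` (H \<inter> A) = H \<inter> B\<close> enters: the inclusion \<open>\<subseteq>\<close> serves \<open>t\<^sup>-\<^sup>1\<close>, the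
  inclusion \<open>\<supseteq>\<close> serves \<open>t\<close>.
\<close>

lemma slide_sub:
  assumes "s \<in> side e" "s \<in> H"
  shows "slide e s \<in> H"
proof (cases e)
  case True
  then obtain a where "a \<in> H \<inter> A" "s = \<phi> a"
    using assms compatible by (auto simp: side_def)
  then show ?thesis
    using True bij_phi by (simp add: slide_def bij_betw_inv_into_left)
next
  case False
  then show ?thesis using assms compatible by (auto simp: slide_def side_def)
qed

text \<open>
  The sliding rule is already a consequence of the relations of the smaller HNN-extension.
  It comes from \<open>t\<^sup>-\<^sup>1 a t = \<phi>(a)\<close> by multiplying with \<open>t\<close> on the left or with \<open>t\<^sup>-\<^sup>1\<close> on the
  right.
\<close>

lemma slide_in_sub_hnn:
  assumes s: "s \<in> side e" "s \<in> H"
  shows "sub_cong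
    [stable_power e, Base s] [Base (slide e s), stable_power e]"
proof -
  note [trans] = hnn_cong.trans
  (* The element of A in the relation to be used: s itself if the exponent is -1, and its
     preimage under \<phi> if the exponent is 1. *)
  define a where "a = (if e then slide e s else s)"
  have a: "a \<in> H" "a \<in> A" "\<phi> a \<in> H"
    using s slide_closed[OF s(1)] slide_sub[OF s] slide_slide[OF s(1)]
    by (auto simp: a_def side_def slide_def split: if_splits)
  have conj: "sub_cong [StableInv, Base a, Stable] [Base (\<phi> a)]"
    using hnn_cong.conjugate[of a sub_assoc sub_base sub_phi] a by simp
  show ?thesis
  proof (cases e)
    case True
    have "sub_cong ([Stable] @ [Base (\<phi> a)]) ([Stable] @ [StableInv, Base a, Stable])"
      using a by (intro hnn_cong.append hnn_cong.sym[OF conj] hnn_cong.refl) simp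
    also have "sub_cong ([Stable] @ [StableInv, Base a, Stable]) ([] @ [Base a, Stable])"
      using a hnn_cong.append[OF hnn_cong.stable_inv_right
          hnn_cong.refl[of "[Base a, Stable]" sub_base sub_assoc sub_phi]] by simp
    finally show ?thesis
      using True slide_slide[OF s(1)] by (simp add: a_def slide_def stable_power_def)
  next
    case False
    have "sub_cong ([StableInv, Base a] @ []) ([StableInv, Base a] @ [Stable, StableInv])"
      using a by (intro hnn_cong.append hnn_cong.sym[OF hnn_cong.stable_inv_right] hnn_cong.refl) simp
    also have "sub_cong ([StableInv, Base a] @ [Stable, StableInv]) ([Base (\<phi> a)] @ [StableInv])"
      using a hnn_cong.append[OF conj
          hnn_cong.refl[of "[StableInv]" sub_base sub_assoc sub_phi]] by simp
    finally show ?thesis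
      using False by (simp add: a_def slide_def stable_power_def)
  qed
qed

section \<open>Coset representatives adapted to the subgroup\<close>

text \<open>
  Representing the trivial coset by \<open>\<one>\<close> makes normal forms recognise cancellable
  syllables. Choosing the other representatives in \<open>H\<close> where possible makes the normal forms
  over \<open>H\<close> normal forms over \<open>G\<close>. The two wishes agree because \<open>\<one> \<in> H\<close>.
\<close>

definition coset_rep :: "'a set \<Rightarrow> 'a" where
  "coset_rep C = (SOME x. x \<in> C \<and> (\<one> \<in> C \<longrightarrow> x = \<one>) \<and> (C \<inter> H \<noteq> {} \<longrightarrow> x \<in> H))"

definition rep :: "bool \<Rightarrow> 'a \<Rightarrow> 'a" where
  "rep e g = coset_rep (side e #> g)"

lemma coset_rep:
  assumes "C \<noteq> {}"
  shows "coset_rep C \<in> C" "\<one> \<in> C \<Longrightarrow> coset_rep C = \<one>" "C \<inter> H \<noteq> {} \<Longrightarrow> coset_rep C \<in> H"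
proof -
  have "\<exists>x. x \<in> C \<and> (\<one> \<in> C \<longrightarrow> x = \<one>) \<and> (C \<inter> H \<noteq> {} \<longrightarrow> x \<in> H)"
    using assms subgroup.one_closed[OF H] by blast
  from someI_ex[OF this]
  show "coset_rep C \<in> C" "\<one> \<in> C \<Longrightarrow> coset_rep C = \<one>" "C \<inter> H \<noteq> {} \<Longrightarrow> coset_rep C \<in> H"
    by (auto simp: coset_rep_def)
qed

context
  fixes e :: bool and g :: 'a
  assumes g: "g \<in> carrier G"
begin

lemma self_in_coset: "g \<in> side e #> g"
  using g subgroup_side by (simp add: rcos_self)

lemma rep_in_coset: "rep e g \<in> side e #> g"
  unfolding rep_def using coset_rep(1) self_in_coset by blast

lemma rep_carrier: "rep e g \<in> carrier G"
  using rep_in_coset g subgroup_side r_coset_subset_G subgroup.subset by blast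

lemma coset_rep_eq: "side e #> rep e g = side e #> g"
  using repr_independence[OF rep_in_coset g subgroup_side] by simp

lemma rep_rep: "rep e (rep e g) = rep e g"
  using coset_rep_eq by (simp add: rep_def)

lemma rep_sub: "g \<in> H \<Longrightarrow> rep e g \<in> H"
  unfolding rep_def using coset_rep(3) self_in_coset by blast

lemma rep_side: "g \<in> side e \<Longrightarrow> rep e g = \<one>"
proof -
  assume "g \<in> side e"
  then have "side e #> g = side e" using g subgroup_side by (intro coset_join2)
  then show ?thesis
    unfolding rep_def using coset_rep(2)[of "side e"] subgroup.one_closed[OF subgroup_side] by auto
qed

lemma rep_eq_one: "rep e g = \<one> \<longleftrightarrow> g \<in> side e"
proof
  assume "rep e g = \<one>"
  then have "side e #> g = side e"
    using coset_rep_eq subgroup.subset[OF subgroup_side, of e] by (simp add: coset_mult_one)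
  then show "g \<in> side e" using self_in_coset by simp
qed (rule rep_side)

lemma rep_mult: "s \<in> side e \<Longrightarrow> rep e (s \<otimes> g) = rep e g"
proof -
  assume s: "s \<in> side e"
  then have "side e #> s = side e" using side_carrier subgroup_side by (intro coset_join2) auto
  then have "side e #> (s \<otimes> g) = side e #> g"
    using coset_mult_assoc[of "side e" s g] g s side_carrier subgroup.subset[OF subgroup_side, of e]
    by simp
  then show ?thesis by (simp add: rep_def)
qed

lemma rep_quotient: "g \<otimes> inv (rep e g) \<in> side e"
proof -
  obtain s where s: "s \<in> side e" "rep e g = s \<otimes> g"
    using rep_in_coset by (auto simp: r_coset_def)
  then have "g \<otimes> inv (rep e g) = inv s"
    using g side_carrier by (simp add: inv_mult_group flip: m_assoc)
  then show ?thesis using s subgroup_side by (simp add: subgroup.m_inv_closed)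
qed

lemma rep_quotient_mult: "g \<otimes> inv (rep e g) \<otimes> rep e g = g"
  using g rep_carrier by (simp add: m_assoc)

end

section \<open>The action on normal forms\<close>

type_synonym 'b normal_form = "'b \<times> (bool \<times> 'b) list"

text \<open>
  The pair \<open>(g, [(e\<^sub>1, r\<^sub>1), \<dots>, (e\<^sub>n, r\<^sub>n)])\<close> stands for \<open>g t\<^bsup>e\<^sub>1\<^esup> r\<^sub>1 \<dots> t\<^bsup>e\<^sub>n\<^esup> r\<^sub>n\<close>.
  The condition on \<open>r = \<one>\<close> excludes the subwords \<open>t\<^sup>e \<one> t\<^sup>-\<^sup>e\<close>.
\<close>

fun normal_tail :: "(bool \<times> 'a) list \<Rightarrow> bool" where
  "normal_tail [] \<longleftrightarrow> True"
| "normal_tail ((e, r) # L) \<longleftrightarrow> r \<in> carrier G \<and> rep e r = r \<and>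
     (r = \<one> \<longrightarrow> L = [] \<or> fst (hd L) = e) \<and> normal_tail L"

definition normal_forms :: "'a normal_form set" where
  "normal_forms = {(g, L). g \<in> carrier G \<and> normal_tail L}"

definition sub_forms :: "'a normal_form set" where
  "sub_forms = {(g, L). g \<in> H \<and> normal_tail L \<and> snd ` set L \<subseteq> H}"

text \<open>
  Left multiplication by \<open>t\<^sup>e\<close>. If \<open>g \<in> side e\<close> meets a following \<open>t\<^sup>-\<^sup>e r\<close>, then
  \<open>t\<^sup>e g t\<^sup>-\<^sup>e r = slide e g r\<close>. Otherwise \<open>g = s r\<close> with \<open>r\<close> its coset representative, and
  \<open>t\<^sup>e s r = slide e s t\<^sup>e r\<close> adds a syllable.
\<close>

fun turn :: "bool \<Rightarrow> 'a normal_form \<Rightarrow> 'a normal_form" where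
  "turn e (g, L) =
    (if g \<in> side e \<and> L \<noteq> [] \<and> fst (hd L) = (\<not> e)
     then (slide e g \<otimes> snd (hd L), tl L)
     else (slide e (g \<otimes> inv (rep e g)), (e, rep e g) # L))"

fun act_letter :: "'a hnn_letter \<Rightarrow> 'a normal_form \<Rightarrow> 'a normal_form" where
  "act_letter (Base x) (g, L) = (x \<otimes> g, L)"
| "act_letter Stable n = turn True n"
| "act_letter StableInv n = turn False n"

abbreviation act :: "'a hnn_letter list \<Rightarrow> 'a normal_form \<Rightarrow> 'a normal_form" where
  "act \<equiv> foldr act_letter"

lemma turn_closed:
  assumes "n \<in> normal_forms"
  shows "turn e n \<in> normal_forms"
proof -
  obtain g L where n: "n = (g, L)" by (cases n)
  have g: "g \<in> carrier G" and L: "normal_tail L" using assms n by (auto simp: normal_forms_def)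
  show ?thesis
  proof (cases "g \<in> side e \<and> L \<noteq> [] \<and> fst (hd L) = (\<not> e)")
    case True
    then obtain r K where K: "L = (\<not> e, r) # K" by (cases L) auto
    then show ?thesis
      using True L slide_carrier[of g e] by (simp add: n normal_forms_def)
  next
    case False
    then have "rep e g = \<one> \<longrightarrow> L = [] \<or> fst (hd L) = e"
      using rep_eq_one[OF g] by auto
    then show ?thesis
      unfolding n turn.simps if_not_P[OF False] using g L slide_carrier[OF rep_quotient[OF g]]
      by (simp add: normal_forms_def rep_carrier rep_rep)
  qed
qed

text \<open>
  A syllable that was added is removed again, whatever follows it. In the other direction,
  a syllable \<open>t\<^sup>-\<^sup>e r\<close> that was cancelled has to be recovered, and this is what normality is for:
  multiplying \<open>slide e g r\<close> by \<open>t\<^sup>-\<^sup>e\<close> adds a syllable, since the only situation in which it would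
  cancel one is \<open>r = \<one>\<close> followed by \<open>t\<^sup>e\<close>; and the representative it adds is \<open>r\<close> itself.
\<close>

lemma turn_turn:
  assumes "n \<in> normal_forms"
  shows "turn (\<not> e) (turn e n) = n"
proof -
  obtain g L where n: "n = (g, L)" by (cases n)
  have g: "g \<in> carrier G" and L: "normal_tail L" using assms n by (auto simp: normal_forms_def)
  show ?thesis
  proof (cases "g \<in> side e \<and> L \<noteq> [] \<and> fst (hd L) = (\<not> e)")
    case True
    then obtain r K where K0: "L = (\<not> e, r) # K" by (cases L) auto
    with L have K: "L = (\<not> e, r) # K" "r \<in> carrier G" "rep (\<not> e) r = r"
        "r = \<one> \<longrightarrow> K = [] \<or> fst (hd K) = (\<not> e)"
      by simp_all
    have s: "slide e g \<in> side (\<not> e)" using True slide_closed by blast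
    have c: "slide e g \<in> carrier G" using s side_carrier by blast
    (* slide e g lies in side (~ e), so it does not change the coset of r. *)
    have rep: "rep (\<not> e) (slide e g \<otimes> r) = r"
      using rep_mult[OF K(2) s] K(3) by simp
    then have fresh: "\<not> (slide e g \<otimes> r \<in> side (\<not> e) \<and> K \<noteq> [] \<and> fst (hd K) = (\<not> \<not> e))"
      using rep_side[of "slide e g \<otimes> r" "\<not> e"] c K(2,4) by auto
    have "turn e n = (slide e g \<otimes> r, K)"
      using True by (simp add: n K(1))
    then have "turn (\<not> e) (turn e n) = (slide (\<not> e) (slide e g \<otimes> r \<otimes> inv r), (\<not> e, r) # K)"
      by (simp only: turn.simps if_not_P[OF fresh] rep)
    moreover have "slide e g \<otimes> r \<otimes> inv r = slide e g"
      using c K(2) by (simp add: m_assoc)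
    ultimately show ?thesis
      using True slide_slide[of g e] by (simp add: n K(1))
  next
    case False
    have q: "g \<otimes> inv (rep e g) \<in> side e" by (rule rep_quotient[OF g])
    show ?thesis
      unfolding n turn.simps if_not_P[OF False]
      using slide_closed[OF q] slide_slide[OF q] rep_quotient_mult[OF g] by simp
  qed
qed

text \<open>
  Multiplying \<open>g\<close> by \<open>s \<in> side e\<close> changes neither its coset nor the case that applies to it.
  Together with \<open>turn_turn\<close> this yields the relation \<open>t\<^sup>-\<^sup>1 a t = \<phi>(a)\<close> for the action.
\<close>

lemma turn_slide:
  assumes "n \<in> normal_forms" and s: "s \<in> side e"
  shows "turn e (act_letter (Base s) n) = act_letter (Base (slide e s)) (turn e n)"
proof -
  obtain g L where n: "n = (g, L)" by (cases n)
  have g: "g \<in> carrier G" and L: "normal_tail L" using assms n by (auto simp: normal_forms_def)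
  have sc: "s \<in> carrier G" using s side_carrier by blast
  have side: "s \<otimes> g \<in> side e \<longleftrightarrow> g \<in> side e"
    using rep_mult[OF g s] rep_eq_one[OF g, of e] rep_eq_one[OF m_closed[OF sc g], of e] by simp
  have rep: "rep e (s \<otimes> g) = rep e g" by (rule rep_mult[OF g s])
  show ?thesis
  proof (cases "g \<in> side e \<and> L \<noteq> [] \<and> fst (hd L) = (\<not> e)")
    case True
    then obtain r K where K0: "L = (\<not> e, r) # K" by (cases L) auto
    with L have K: "L = (\<not> e, r) # K" "r \<in> carrier G" by simp_all
    then show ?thesis
      using True s by (simp add: n side slide_mult m_assoc slide_carrier)
  next
    case False
    have q: "g \<otimes> inv (rep e g) \<in> side e" by (rule rep_quotient[OF g])
    have "s \<otimes> g \<otimes> inv (rep e g) = s \<otimes> (g \<otimes> inv (rep e g))"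
      using g sc by (simp add: m_assoc rep_carrier)
    then show ?thesis
      using False slide_mult[OF s q] by (auto simp: n side rep)
  qed
qed

lemma act_letter_closed:
  "[l] \<in> hnn_words G \<Longrightarrow> n \<in> normal_forms \<Longrightarrow> act_letter l n \<in> normal_forms"
  using turn_closed by (cases l) (auto simp: normal_forms_def)

lemma act_closed: "w \<in> hnn_words G \<Longrightarrow> n \<in> normal_forms \<Longrightarrow> act w n \<in> normal_forms"
  by (induction w) (auto intro!: act_letter_closed)

theorem act_cong:
  assumes "hnn_cong G A \<phi> u v" "n \<in> normal_forms"
  shows "act u n = act v n"
  using assms
proof (induction arbitrary: n rule: hnn_cong.induct)
  case (append u u' v v')
  have "v \<in> hnn_words G" using append.hyps(2) cong_words by blast
  then have "act v n \<in> normal_forms" using append.prems act_closed by blast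
  from append.IH(1)[OF this] append.IH(2)[OF append.prems] show ?case by simp
next
  case base_one
  then show ?case by (auto simp: normal_forms_def)
next
  case (base_mult x y)
  then show ?case by (auto simp: normal_forms_def m_assoc)
next
  case stable_inv_right
  then show ?case using turn_turn[of n False] by simp
next
  case stable_inv_left
  then show ?case using turn_turn[of n True] by simp
next
  case (conjugate a)
  then have "turn False (act_letter (Base a) (turn True n))
      = act_letter (Base (slide False a)) (turn False (turn True n))"
    by (intro turn_slide turn_closed) (simp_all add: side_def)
  then show ?case using turn_turn[of n True] conjugate by (simp add: slide_def)
next
  case (refl w)
  show ?case by (rule HOL.refl)
next
  case (sym u v)
  show ?case by (rule sym.IH[OF sym.prems, symmetric])
next
  case (trans u v w)
  show ?case by (rule HOL.trans[OF trans.IH(1)[OF trans.prems] trans.IH(2)[OF trans.prems]])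
qed

section \<open>Normal forms over the subgroup\<close>

fun spell :: "'a normal_form \<Rightarrow> 'a hnn_letter list" where
  "spell (g, L) = Base g # concat (map (\<lambda>(e, r). [stable_power e, Base r]) L)"

lemma sub_forms_normal: "n \<in> sub_forms \<Longrightarrow> n \<in> normal_forms"
  by (auto simp: sub_forms_def normal_forms_def H_carrier)

lemma stable_power_word: "[stable_power e] \<in> hnn_words sub_base"
  by (simp add: stable_power_def)

lemma spell_tail_word:
  "snd ` set L \<subseteq> H \<Longrightarrow>
    concat (map (\<lambda>(e, r). [stable_power e, Base r]) L) \<in> hnn_words sub_base"
  by (induction L) (auto simp: stable_power_def)

lemma spell_word: "n \<in> sub_forms \<Longrightarrow> spell n \<in> hnn_words sub_base"
  using spell_tail_word by (cases n) (auto simp: sub_forms_def)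

text \<open>
  Normalisation over \<open>H\<close> stays over \<open>H\<close>, and it is a computation in the smaller HNN-extension:
  cancelling uses \<open>slide_in_sub_hnn\<close> and \<open>t\<^sup>e t\<^sup>-\<^sup>e = 1\<close>, adding a syllable
  uses the factorisation \<open>g = s r\<close> inside \<open>H\<close> and \<open>slide_in_sub_hnn\<close>.
\<close>

lemma sub_turn:
  assumes "n \<in> sub_forms"
  shows "turn e n \<in> sub_forms"
    and "sub_cong (spell (turn e n)) (stable_power e # spell n)"
proof -
  let ?tail = "\<lambda>L. concat (map (\<lambda>(e, r). [stable_power e, Base r]) L)"
  note [trans] = hnn_cong.trans
  note [simp] = stable_power_word[simplified]
  obtain g L where n: "n = (g, L)" by (cases n)
  have g: "g \<in> H" and L: "normal_tail L" "snd ` set L \<subseteq> H"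
    using assms n by (auto simp: sub_forms_def)
  have gc: "g \<in> carrier G" using g by (rule H_carrier)
  have normal: "turn e n \<in> normal_forms" using assms sub_forms_normal turn_closed by blast
  have in_context: "sub_cong (p @ u @ q) (p @ v @ q)"
    if "sub_cong u v" "p \<in> hnn_words sub_base" "q \<in> hnn_words sub_base" for p u v q
    using that by (intro hnn_cong.append hnn_cong.refl)
  have "turn e n \<in> sub_forms \<and> sub_cong (stable_power e # spell n) (spell (turn e n))"
  proof (cases "g \<in> side e \<and> L \<noteq> [] \<and> fst (hd L) = (\<not> e)")
    case True
    then obtain r K where K0: "L = (\<not> e, r) # K" by (cases L) auto
    with L have K: "L = (\<not> e, r) # K" "r \<in> carrier G" "normal_tail K" by simp_all
    have r: "r \<in> H" and tail: "?tail K \<in> hnn_words sub_base"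
      using L K spell_tail_word by auto
    have s: "slide e g \<in> H" using True g slide_sub by blast
    have "sub_cong ([] @ [stable_power e, Base g] @ (stable_power (\<not> e) # Base r # ?tail K))
        ([] @ [Base (slide e g), stable_power e] @ (stable_power (\<not> e) # Base r # ?tail K))"
      using True g r tail by (intro in_context slide_in_sub_hnn) auto
    also have "sub_cong \<dots> ([Base (slide e g)] @ [] @ Base r # ?tail K)"
    proof -
      have "sub_cong [stable_power e, stable_power (\<not> e)] []"
        by (simp add: stable_power_def hnn_cong.stable_inv_left hnn_cong.stable_inv_right)
      from in_context[OF this, of "[Base (slide e g)]" "Base r # ?tail K"]
      show ?thesis using r s tail by simp
    qed
    also have "sub_cong \<dots> ([] @ [Base (slide e g \<otimes> r)] @ ?tail K)"
      using in_context[of "[Base (slide e g), Base r]" "[Base (slide e g \<otimes> r)]" "[]" "?tail K"]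
        hnn_cong.base_mult[of "slide e g" sub_base r sub_assoc sub_phi] r s tail by simp
    finally have "sub_cong (stable_power e # spell n) (spell (turn e n))"
      using True by (simp add: n K)
    moreover have "turn e n \<in> sub_forms"
      using True K L r s H by (auto simp: n sub_forms_def subgroup.m_closed)
    ultimately show ?thesis by blast
  next
    case False
    define r where "r = rep e g"
    define s where "s = g \<otimes> inv r"
    have turn: "turn e n = (slide e s, (e, r) # L)"
      unfolding n turn.simps if_not_P[OF False] r_def s_def by simp
    have r: "r \<in> H" unfolding r_def using g gc by (simp add: rep_sub)
    have s: "s \<in> H" "s \<in> side e"
      using g r H rep_quotient[OF gc]
      by (auto simp: s_def r_def subgroup.m_closed subgroup.m_inv_closed)
    have sr: "s \<otimes> r = g" unfolding s_def r_def by (rule rep_quotient_mult[OF gc])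
    have tail: "?tail L \<in> hnn_words sub_base" using L spell_tail_word by auto
    have "sub_cong [Base s, Base r] [Base g]"
      using hnn_cong.base_mult[of s sub_base r sub_assoc sub_phi] r s sr by simp
    then have "sub_cong ([stable_power e] @ [Base g] @ ?tail L)
        ([stable_power e] @ [Base s, Base r] @ ?tail L)"
      using tail by (intro in_context hnn_cong.sym[of _ _ _ "[Base s, Base r]"]) auto
    also have "sub_cong \<dots> ([] @ [Base (slide e s), stable_power e] @ Base r # ?tail L)"
      using in_context[OF slide_in_sub_hnn[OF s(2,1)], of "[]" "Base r # ?tail L"] r tail by simp
    finally have "sub_cong (stable_power e # spell n) (spell (turn e n))"
      unfolding turn by (simp add: n)
    moreover have "turn e n \<in> sub_forms"
      using normal L r slide_sub[OF s(2,1)] 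
      unfolding turn by (auto simp: sub_forms_def normal_forms_def)
    ultimately show ?thesis by blast
  qed
  then show "turn e n \<in> sub_forms" "sub_cong (spell (turn e n)) (stable_power e # spell n)"
    by (auto intro: hnn_cong.sym)
qed

lemma sub_act_letter:
  assumes n: "n \<in> sub_forms" and l: "[l] \<in> hnn_words sub_base"
  shows "act_letter l n \<in> sub_forms"
    and "sub_cong (spell (act_letter l n)) (l # spell n)"
proof -
  have "act_letter l n \<in> sub_forms \<and> sub_cong (spell (act_letter l n)) (l # spell n)"
  proof (cases l)
    case (Base x)
    obtain g L where nL: "n = (g, L)" by (cases n)
    have x: "x \<in> H" using l Base by simp
    have g: "g \<in> H" and L: "snd ` set L \<subseteq> H" using n nL by (auto simp: sub_forms_def)
    have "sub_cong ([Base (x \<otimes> g)] @ concat (map (\<lambda>(e, r). [stable_power e, Base r]) L))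
        ([Base x, Base g] @ concat (map (\<lambda>(e, r). [stable_power e, Base r]) L))"
      using hnn_cong.base_mult[of x sub_base g sub_assoc sub_phi] x g spell_tail_word[OF L]
      by (intro hnn_cong.append hnn_cong.refl) (auto intro: hnn_cong.sym)
    then show ?thesis
      using n x g H by (auto simp: Base nL sub_forms_def subgroup.m_closed)
  next
    case Stable
    then show ?thesis using sub_turn[OF n, of True] by (simp add: stable_power_def)
  next
    case StableInv
    then show ?thesis using sub_turn[OF n, of False] by (simp add: stable_power_def)
  qed
  then show "act_letter l n \<in> sub_forms" "sub_cong (spell (act_letter l n)) (l # spell n)" by auto
qed

lemma sub_act:
  assumes "w \<in> hnn_words sub_base" and n: "n \<in> sub_forms"
  shows "act w n \<in> sub_forms \<and>
    sub_cong (spell (act w n)) (w @ spell n)"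
  using assms(1)
proof (induction w)
  case Nil
  then show ?case using n spell_word by (simp add: hnn_cong.refl)
next
  case (Cons l w)
  then have l: "[l] \<in> hnn_words sub_base" and w: "w \<in> hnn_words sub_base" by auto
  have IH: "act w n \<in> sub_forms"
      "sub_cong (spell (act w n)) (w @ spell n)"
    using Cons.IH[OF w] by blast+
  have "sub_cong ([l] @ spell (act w n)) ([l] @ (w @ spell n))"
    using IH(2) l by (intro hnn_cong.append hnn_cong.refl)
  then show ?case
    using sub_act_letter[OF IH(1) l] by (auto intro: hnn_cong.trans)
qed

lemma origin_sub_form: "(\<one>, []) \<in> sub_forms"
  by (simp add: sub_forms_def subgroup.one_closed[OF H])

text \<open>
  The word \<open>w\<close> can be recovered, up to the relations of the smaller HNN-extension, from its action
  on a single point. Since equality in the larger extension determines that action, it implies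
  equality in the smaller one.
\<close>

lemma sub_spell_act_origin:
  assumes w: "w \<in> hnn_words sub_base"
  shows "sub_cong (spell (act w (\<one>, []))) w"
proof -
  have "sub_cong (w @ [Base \<one>]) (w @ [])"
    using w hnn_cong.base_one[of sub_base] by (intro hnn_cong.append hnn_cong.refl) auto
  then show ?thesis
    using sub_act[OF w origin_sub_form] by (auto intro: hnn_cong.trans)
qed

theorem sub_cong_if_cong:
  assumes "u \<in> hnn_words sub_base" "v \<in> hnn_words sub_base" "hnn_cong G A \<phi> u v"
  shows "sub_cong u v"
  using act_cong[OF assms(3) sub_forms_normal[OF origin_sub_form]]
    sub_spell_act_origin[OF assms(1)] sub_spell_act_origin[OF assms(2)]
  by (metis hnn_cong.sym hnn_cong.trans)

text \<open>
  The word \<open>w\<close> and the element \<open>g\<close> take the trivial normal form to the same place; the former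
  stays among the normal forms over \<open>H\<close>, and the latter reaches \<open>(g, [])\<close>.
\<close>

theorem sub_word_in_base:
  assumes w: "w \<in> hnn_words sub_base" and g: "g \<in> carrier G" and "hnn_cong G A \<phi> w [Base g]"
  shows "g \<in> H"
proof -
  have "act w (\<one>, []) = (g, [])"
    using act_cong[OF assms(3) sub_forms_normal[OF origin_sub_form]] g by simp
  then show ?thesis using sub_act[OF w origin_sub_form] by (simp add: sub_forms_def)
qed

section \<open>The subgroup generated by the smaller base and the stable letter\<close>

lemma sub_words: "w \<in> hnn_words sub_base \<Longrightarrow> w \<in> hnn_words G"
  by (induction w) (auto simp: H_carrier split: hnn_letter.splits)

lemma generate_eq_words:
  "generate (hnn G A \<phi>) (hnn_base G A \<phi> ` H \<union> {hnn_stable G A \<phi>}) = cls ` hnn_words sub_base"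
  (is "generate ?\<Gamma> ?S = _")
proof
  interpret \<Gamma>: group ?\<Gamma> by (rule group_hnn)
  have inverse: "inv\<^bsub>?\<Gamma>\<^esub> (hnn_base G A \<phi> x) = hnn_base G A \<phi> (inv x)" if "x \<in> H" for x
  proof -
    interpret b: group_hom G ?\<Gamma> "hnn_base G A \<phi>"
      using base_hom by unfold_locales
    show ?thesis using that H_carrier by simp
  qed
  show "generate ?\<Gamma> ?S \<subseteq> cls ` hnn_words sub_base"
  proof
    fix U assume "U \<in> generate ?\<Gamma> ?S"
    then show "U \<in> cls ` hnn_words sub_base"
    proof induction
      case one
      show ?case by (auto simp: one_hnn)
    next
      case (incl U)
      then consider x where "x \<in> H" "U = cls [Base x]" | "U = cls [Stable]"
        by (auto simp: hnn_base_def hnn_stable_def)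
      then show ?case by cases (auto intro!: imageI)
    next
      case (inv U)
      then consider x where "x \<in> H" "inv\<^bsub>?\<Gamma>\<^esub> U = cls [Base (inv x)]"
        | "inv\<^bsub>?\<Gamma>\<^esub> U = cls [StableInv]"
        using inverse inv_stable by (auto simp: hnn_base_def)
      then show ?case using subgroup.m_inv_closed[OF H] by cases (auto intro!: imageI)
    next
      case (eng U V)
      then obtain u v where "u \<in> hnn_words sub_base" "U = cls u" "v \<in> hnn_words sub_base" "V = cls v"
        by blast
      then show ?case using sub_words by (auto simp: mult_hnn intro!: imageI)
    qed
  qed
  show "cls ` hnn_words sub_base \<subseteq> generate ?\<Gamma> ?S"
  proof
    fix U assume "U \<in> cls ` hnn_words sub_base"
    then obtain w where w: "w \<in> hnn_words sub_base" "U = cls w" by blast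
    have "cls w \<in> generate ?\<Gamma> ?S"
      using w(1)
    proof (induction w)
      case Nil
      show ?case using generate.one[of ?\<Gamma>] by (simp add: one_hnn)
    next
      case (Cons l w)
      then have l: "[l] \<in> hnn_words sub_base" and w: "w \<in> hnn_words sub_base" by auto
      have "cls [l] \<in> generate ?\<Gamma> ?S"
      proof (cases l)
        case (Base x)
        then have "cls [l] \<in> ?S" using l by (simp add: hnn_base_def)
        then show ?thesis by (rule generate.incl)
      next
        case Stable
        then have "cls [l] \<in> ?S" by (simp add: hnn_stable_def)
        then show ?thesis by (rule generate.incl)
      next
        case StableInv
        then show ?thesis
          using generate.inv[of "hnn_stable G A \<phi>" ?S ?\<Gamma>] by (simp add: inv_stable)
      qed
      then show ?case
        using generate.eng[OF _ Cons.IH[OF w]] mult_hnn[OF sub_words[OF l] sub_words[OF w]] by fastforce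
    qed
    then show "U \<in> generate ?\<Gamma> ?S" using w by simp
  qed
qed

text \<open>
  A word over \<open>H\<close> is also a word over \<open>G\<close>; on representatives the natural homomorphism is this
  inclusion.
\<close>

lemma natural_hom_exists:
  obtains h where "h \<in> hom (hnn sub_base sub_assoc sub_phi) (hnn G A \<phi>)"
    and "\<And>w. w \<in> hnn_words sub_base \<Longrightarrow> h (sub.cls w) = cls w"
proof -
  let ?\<Sigma> = "hnn sub_base sub_assoc sub_phi" and ?\<Gamma> = "hnn G A \<phi>"
  have base: "hnn_base G A \<phi> \<in> hom sub_base ?\<Gamma>"
    using base_hom H_carrier by (auto simp: hom_def)
  obtain h where h: "h \<in> hom ?\<Sigma> ?\<Gamma>"
      "\<And>g. g \<in> H \<Longrightarrow> h (hnn_base sub_base sub_assoc sub_phi g) = hnn_base G A \<phi> g"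
      "h (hnn_stable sub_base sub_assoc sub_phi) = hnn_stable G A \<phi>"
    using sub.hnn_lift_exists[OF group_hnn base stable_closed] stable_conj by auto
  interpret h: group_hom ?\<Sigma> ?\<Gamma> h
    using h(1) group_hnn sub.group_hnn by (simp add: group_hom_def group_hom_axioms_def)
  have inv: "h (sub.cls [StableInv]) = cls [StableInv]"
    using h(3) h.hom_inv[OF sub.stable_closed] by (simp add: inv_stable sub.inv_stable)
  have "h (sub.cls w) = cls w" if "w \<in> hnn_words sub_base" for w
    using that
  proof (induction w)
    case Nil
    show ?case using h.hom_one by (simp add: one_hnn sub.one_hnn)
  next
    case (Cons l w)
    then have l: "[l] \<in> hnn_words sub_base" and w: "w \<in> hnn_words sub_base" by auto
    have "h (sub.cls [l]) = cls [l]"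
      using l h(2,3) inv by (cases l) (auto simp: hnn_base_def hnn_stable_def)
    moreover have "sub.cls [l] \<in> carrier ?\<Sigma>" "sub.cls w \<in> carrier ?\<Sigma>"
      using l w unfolding sub.carrier_hnn by blast+
    ultimately show ?case
      using h.hom_mult[of "sub.cls [l]" "sub.cls w"] sub.mult_hnn[OF l w]
        mult_hnn[OF sub_words[OF l] sub_words[OF w]] Cons.IH[OF w] by simp
  qed
  then show ?thesis using that h(1) by blast
qed

theorem natural_hom_embedding:
  "\<exists>h \<in> hom (hnn sub_base sub_assoc sub_phi) (hnn G A \<phi>).
     (\<forall>g \<in> H. h (hnn_base sub_base sub_assoc sub_phi g) = hnn_base G A \<phi> g) \<and>
     h (hnn_stable sub_base sub_assoc sub_phi) = hnn_stable G A \<phi> \<and>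
     inj_on h (carrier (hnn sub_base sub_assoc sub_phi)) \<and>
     h ` carrier (hnn sub_base sub_assoc sub_phi)
       = generate (hnn G A \<phi>) (hnn_base G A \<phi> ` H \<union> {hnn_stable G A \<phi>})"
proof -
  obtain h where h: "h \<in> hom (hnn sub_base sub_assoc sub_phi) (hnn G A \<phi>)"
      "\<And>w. w \<in> hnn_words sub_base \<Longrightarrow> h (sub.cls w) = cls w"
    using natural_hom_exists by blast
  have "inj_on h (carrier (hnn sub_base sub_assoc sub_phi))"
  proof (rule inj_onI)
    fix U V
    assume UV: "U \<in> carrier (hnn sub_base sub_assoc sub_phi)"
        "V \<in> carrier (hnn sub_base sub_assoc sub_phi)" and eq: "h U = h V"
    obtain u v where u: "u \<in> hnn_words sub_base" "U = sub.cls u"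
      and v: "v \<in> hnn_words sub_base" "V = sub.cls v"
      using UV unfolding sub.carrier_hnn by blast
    have "hnn_cong G A \<phi> u v" using eq u v by (simp add: h(2) cls_eq_iff sub_words)
    then show "U = V" using u v sub_cong_if_cong by (simp add: sub.cls_eqI)
  qed
  moreover have "h ` carrier (hnn sub_base sub_assoc sub_phi) = cls ` hnn_words sub_base"
    unfolding sub.carrier_hnn image_image using h(2) by (rule image_cong[OF HOL.refl])
  ultimately show ?thesis
    unfolding generate_eq_words using h
    by (intro bexI[of _ h]) (auto simp: hnn_base_def hnn_stable_def)
qed

theorem generate_inter_base:
  assumes "K \<subseteq> carrier G"
  shows "generate (hnn G A \<phi>) (hnn_base G A \<phi> ` H \<union> {hnn_stable G A \<phi>}) \<inter> hnn_base G A \<phi> ` K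
    = hnn_base G A \<phi> ` (H \<inter> K)"
proof -
  have "x \<in> H" if "x \<in> K" "w \<in> hnn_words sub_base" "hnn_base G A \<phi> x = cls w" for x w
  proof (rule sub_word_in_base[OF that(2)])
    show x: "x \<in> carrier G" using assms that(1) by blast
    show "hnn_cong G A \<phi> w [Base x]"
      using that(3) x by (simp add: hnn_base_def cls_eq_iff sub_words[OF that(2)] hnn_cong.sym)
  qed
  moreover have "hnn_base G A \<phi> x \<in> cls ` hnn_words sub_base" if "x \<in> H" for x
    using that by (simp add: hnn_base_def)
  ultimately show ?thesis unfolding generate_eq_words by blast
qed

end

theorem lemma3p4:
  fixes G :: "('a, 'm) monoid_scheme"
    and A B G' A' B' :: "'a set"
    and \<phi> \<phi>' :: "'a \<Rightarrow> 'a"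
    and \<Gamma> :: "'a hnn_letter list set monoid"
    and \<iota> :: "'a \<Rightarrow> 'a hnn_letter list set"
    and t :: "'a hnn_letter list set"
    and \<Gamma>' :: "'a hnn_letter list set set"
  assumes "group G"
    and "subgroup A G"
    and "subgroup B G"
    and "\<phi> \<in> iso (G\<lparr>carrier := A\<rparr>) (G\<lparr>carrier := B\<rparr>)"
    and "\<Gamma> = hnn G A \<phi>"
    and "\<iota> = hnn_base G A \<phi>"
    and "t = hnn_stable G A \<phi>"
    and "subgroup G' G"
    and "A' = G' \<inter> A"
    and "B' = G' \<inter> B"
    and "\<phi> ` A' = B'"
    and "\<Gamma>' = generate \<Gamma> (\<iota> ` G' \<union> {t})"
    and "\<phi>' = restrict \<phi> A'"
  shows "(\<exists>h \<in> hom (hnn (G\<lparr>carrier := G'\<rparr>) A' \<phi>') \<Gamma>.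
            (\<forall>g \<in> G'. h (hnn_base (G\<lparr>carrier := G'\<rparr>) A' \<phi>' g) = \<iota> g) \<and>
            h (hnn_stable (G\<lparr>carrier := G'\<rparr>) A' \<phi>') = t \<and>
            inj_on h (carrier (hnn (G\<lparr>carrier := G'\<rparr>) A' \<phi>')) \<and>
            h ` carrier (hnn (G\<lparr>carrier := G'\<rparr>) A' \<phi>') = \<Gamma>') \<and>
         \<Gamma>' \<inter> \<iota> ` carrier G = \<iota> ` G' \<and>
         \<Gamma>' \<inter> \<iota> ` A = \<iota> ` A' \<and> \<Gamma>' \<inter> \<iota> ` B = \<iota> ` B'"
proof -
  interpret hnn_compatible_subgroup G A B G' \<phi>
    using assms by (simp add: hnn_compatible_subgroup_def hnn_compatible_subgroup_axioms_def)
  have "G' \<inter> carrier G = G'" using H_carrier by blast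
  then show ?thesis
    using natural_hom_embedding generate_inter_base[of "carrier G"] generate_inter_base[of A]
      generate_inter_base[of B] subgroup.subset[OF A] subgroup.subset[OF B]
    unfolding assms(5-7) assms(9,10,12,13) sub_phi_def by simp
qed

end
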